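(* Let $\mathcal{L}=(L,\vee,\wedge,\otimes,\rightarrow,0,1)$ be a residuated lattice satisfying the double negation law. Then $$\mathbf{C}(\mathcal{L}):=((L,\vee,\otimes,0,1),(L,\wedge,\oplus,1,0),\neg)$$ is a general coupled semiring.
   Context: A residuated lattice is an algebra $\mathcal{L}=(L,\vee,\wedge,\otimes,\rightarrow,0,1)$ of type $(2,2,2,2,0,0)$ such that for all $x,y,z\in L$: (i) $(L,\vee,\wedge,0,1)$ is a bounded lattice (with least element $0$, greatest element $1$ and induced order $\leq$); (ii) $(L,\otimes,1)$ is a commutative monoid; (iii) $x\leq y\rightarrow z$ if and only if $x\otimes y\leq z$. In a residuated lattice put $\neg x:=x\rightarrow 0$ and $x\oplus y:=\neg(\neg x\otimes\neg y)$. The residuated lattice satisfies the double negation law if $\neg\neg x=x$ for all $x\in L$. A commutative semiring is an algebra $(S,+,\cdot,0,1)$ of type $(2,2,0,0)$ such that for all $x,y,z\in S$: (i) $(S,+,0)$ and $(S,\cdot,1)$ are commutative monoids; (ii) $x(y+z)=xy+xz$; (iii) $x0=0$. In the notation $(S,+,\cdot,0,1)$ the third and fourth listed items after the carrier set are, in this order, the additive neutral element and the multiplicative neutral element; thus in $(A,\wedge,\ast,1,0)$ the addition is $\wedge$ with neutral element $1$, and the multiplication is $\ast$ with neutral element $0$. Homomorphisms and isomorphisms of semirings preserve both operations and both constants, in the listed order. A general coupled semiring is an ordered triple $((A,\vee,\cdot,0,1),(A,\wedge,\ast,1,0),\alpha)$ such that for all $x,y\in A$: (i) $(A,\vee,\cdot,0,1)$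 and $(A,\wedge,\ast,1,0)$ are commutative semirings; (ii) $(A,\vee,\wedge)$ is a lattice (with induced order $\leq$); (iii) $\alpha$ is an isomorphism from $(A,\vee,\cdot,0,1)$ to $(A,\wedge,\ast,1,0)$; (iv) $\alpha(\alpha(x))=x$; (v) $x\leq y$ if and only if $\alpha(x)\ast y=1$. *)

theory Defs
  imports "HOL-Algebra.QuotRing"
begin

text \<open>Lattices are algebras here, with operations given on a carrier set and axiomatised by the
  lattice identities; idempotence follows from absorption.\<close>

locale lattice_on =
  fixes A :: "'a set" and jn :: "'a \<Rightarrow> 'a \<Rightarrow> 'a" and mt :: "'a \<Rightarrow> 'a \<Rightarrow> 'a"
  assumes jn_closed: "\<And>x y. \<lbrakk>x \<in> A; y \<in> A\<rbrakk> \<Longrightarrow> jn x y \<in> A"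
    and mt_closed: "\<And>x y. \<lbrakk>x \<in> A; y \<in> A\<rbrakk> \<Longrightarrow> mt x y \<in> A"
    and jn_commute: "\<And>x y. \<lbrakk>x \<in> A; y \<in> A\<rbrakk> \<Longrightarrow> jn x y = jn y x"
    and mt_commute: "\<And>x y. \<lbrakk>x \<in> A; y \<in> A\<rbrakk> \<Longrightarrow> mt x y = mt y x"
    and jn_assoc: "\<And>x y z. \<lbrakk>x \<in> A; y \<in> A; z \<in> A\<rbrakk> \<Longrightarrow> jn (jn x y) z = jn x (jn y z)"
    and mt_assoc: "\<And>x y z. \<lbrakk>x \<in> A; y \<in> A; z \<in> A\<rbrakk> \<Longrightarrow> mt (mt x y) z = mt x (mt y z)"
    and jn_mt_absorb: "\<And>x y. \<lbrakk>x \<in> A; y \<in> A\<rbrakk> \<Longrightarrow> jn x (mt x y) = x"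
    and mt_jn_absorb: "\<And>x y. \<lbrakk>x \<in> A; y \<in> A\<rbrakk> \<Longrightarrow> mt x (jn x y) = x"

definition induced_le :: "('a \<Rightarrow> 'a \<Rightarrow> 'a) \<Rightarrow> 'a \<Rightarrow> 'a \<Rightarrow> bool" where
  "induced_le jn x y \<longleftrightarrow> jn x y = y"

locale bounded_lattice_on = lattice_on A jn mt
  for A :: "'a set" and jn :: "'a \<Rightarrow> 'a \<Rightarrow> 'a" and mt :: "'a \<Rightarrow> 'a \<Rightarrow> 'a" +
  fixes b :: 'a and t :: 'a
  assumes least_closed: "b \<in> A"
    and greatest_closed: "t \<in> A"
    and least: "\<And>x. x \<in> A \<Longrightarrow> induced_le jn b x"
    and greatest: "\<And>x. x \<in> A \<Longrightarrow> induced_le jn x t"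

record 'a reslat = "'a partial_object" +
  rl_join :: "'a \<Rightarrow> 'a \<Rightarrow> 'a"
  rl_meet :: "'a \<Rightarrow> 'a \<Rightarrow> 'a"
  rl_mult :: "'a \<Rightarrow> 'a \<Rightarrow> 'a"
  rl_imp :: "'a \<Rightarrow> 'a \<Rightarrow> 'a"
  rl_zero :: 'a
  rl_one :: 'a

definition rl_le :: "('a, 'm) reslat_scheme \<Rightarrow> 'a \<Rightarrow> 'a \<Rightarrow> bool" where
  "rl_le L = induced_le (rl_join L)"

definition residuated_lattice :: "('a, 'm) reslat_scheme \<Rightarrow> bool" where
  "residuated_lattice L \<longleftrightarrow>
     bounded_lattice_on (carrier L) (rl_join L) (rl_meet L) (rl_zero L) (rl_one L) \<and>
     comm_monoid \<lparr>carrier = carrier L, monoid.mult = rl_mult L, one = rl_one L\<rparr> \<and>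
     (\<forall>x\<in>carrier L. \<forall>y\<in>carrier L. rl_imp L x y \<in> carrier L) \<and>
     (\<forall>x\<in>carrier L. \<forall>y\<in>carrier L. \<forall>z\<in>carrier L.
        rl_le L x (rl_imp L y z) \<longleftrightarrow> rl_le L (rl_mult L x y) z)"

definition rl_neg :: "('a, 'm) reslat_scheme \<Rightarrow> 'a \<Rightarrow> 'a" where
  "rl_neg L x = rl_imp L x (rl_zero L)"

definition rl_oplus :: "('a, 'm) reslat_scheme \<Rightarrow> 'a \<Rightarrow> 'a \<Rightarrow> 'a" where
  "rl_oplus L x y = rl_neg L (rl_mult L (rl_neg L x) (rl_neg L y))"

definition double_negation_law :: "('a, 'm) reslat_scheme \<Rightarrow> bool" where
  "double_negation_law L \<longleftrightarrow> (\<forall>x\<in>carrier L. rl_neg L (rl_neg L x) = x)"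

definition comm_semiring :: "('a, 'm) ring_scheme \<Rightarrow> bool" where
  "comm_semiring S \<longleftrightarrow> semiring S \<and> comm_monoid S"

text \<open>The library's \<^const>\<open>ring_iso\<close> does not ask for preservation of the additive neutral element.\<close>

definition semiring_iso :: "('a, 'm) ring_scheme \<Rightarrow> ('b, 'n) ring_scheme \<Rightarrow> ('a \<Rightarrow> 'b) set" where
  "semiring_iso S T = {h \<in> ring_iso S T. h \<zero>\<^bsub>S\<^esub> = \<zero>\<^bsub>T\<^esub>}"

text \<open>In a triple \<open>(S, T, \<alpha>)\<close> the two additions are the join and the meet, the constants of \<open>T\<close>
  are those of \<open>S\<close> in exchanged roles, and \<open>\<one>\<^bsub>S\<^esub>\<close> is the element written 1.\<close>

fun general_coupled_semiring :: "'a ring \<times> 'a ring \<times> ('a \<Rightarrow> 'a) \<Rightarrow> bool" where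
  "general_coupled_semiring (S, T, \<alpha>) \<longleftrightarrow>
     carrier T = carrier S \<and> \<zero>\<^bsub>T\<^esub> = \<one>\<^bsub>S\<^esub> \<and> \<one>\<^bsub>T\<^esub> = \<zero>\<^bsub>S\<^esub> \<and>
     comm_semiring S \<and> comm_semiring T \<and>
     lattice_on (carrier S) (add S) (add T) \<and>
     \<alpha> \<in> semiring_iso S T \<and>
     (\<forall>x\<in>carrier S. \<alpha> (\<alpha> x) = x) \<and>
     (\<forall>x\<in>carrier S. \<forall>y\<in>carrier S. induced_le (add S) x y \<longleftrightarrow> \<alpha> x \<otimes>\<^bsub>T\<^esub> y = \<one>\<^bsub>S\<^esub>)"

definition coupled_of_reslat :: "('a, 'm) reslat_scheme \<Rightarrow> 'a ring \<times> 'a ring \<times> ('a \<Rightarrow> 'a)" where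
  "coupled_of_reslat L =
     (\<lparr>carrier = carrier L, monoid.mult = rl_mult L, one = rl_one L,
        zero = rl_zero L, add = rl_join L\<rparr>,
      \<lparr>carrier = carrier L, monoid.mult = rl_oplus L, one = rl_zero L,
        zero = rl_one L, add = rl_meet L\<rparr>,
      rl_neg L)"

end

theory Submission
  imports Defs
begin

text \<open>Residuation says that, for fixed \<open>x\<close>, the map \<open>y \<mapsto> x \<otimes> y\<close> is a left adjoint. Left adjoints
  preserve the suprema that exist, in particular binary joins and the least element, so
  \<open>(L, \<or>, \<otimes>, 0, 1)\<close> is a commutative semiring. The same adjunction, evaluated at \<open>0\<close>, shows that
  negation turns joins into meets; \<open>\<not> 0 = 1\<close> and \<open>\<not> 1 = 0\<close> are immediate.

  Under the double negation law negation is an involution, hence a bijection, and then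
  \<open>\<not> (x \<otimes> y) = \<not> x \<oplus> \<not> y\<close> is just the definition of \<open>\<oplus>\<close>. So \<open>(L, \<and>, \<oplus>, 1, 0)\<close> is the image of the
  first structure under the bijection \<open>\<not>\<close>, and the semiring laws carry over to it
  (\<open>comm_semiring_transport\<close>) with no separate check for \<open>\<and>\<close> and \<open>\<oplus>\<close>. The remaining condition
  holds because \<open>\<not> x \<oplus> y = \<not> (x \<otimes> \<not> y)\<close>, and \<open>\<not> u = 1\<close> means \<open>u \<le> 0\<close>, so
  that it reduces to \<open>x \<otimes> \<not> y \<le> 0\<close>, which by residuation is \<open>x \<le> \<not> \<not> y = y\<close>.\<close>

section \<open>The induced order of a lattice\<close>

context lattice_on
begin

lemma jn_idem: "x \<in> A \<Longrightarrow> jn x x = x"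
  by (metis jn_mt_absorb mt_jn_absorb jn_closed)

lemma induced_le_refl: "x \<in> A \<Longrightarrow> induced_le jn x x"
  by (simp add: induced_le_def jn_idem)

lemma induced_le_antisym:
  "\<lbrakk>induced_le jn x y; induced_le jn y x; x \<in> A; y \<in> A\<rbrakk> \<Longrightarrow> x = y"
  by (metis induced_le_def jn_commute)

lemma induced_le_trans:
  "\<lbrakk>induced_le jn x y; induced_le jn y z; x \<in> A; y \<in> A; z \<in> A\<rbrakk> \<Longrightarrow> induced_le jn x z"
  by (metis induced_le_def jn_assoc)

lemma induced_le_iff_mt:
  "\<lbrakk>x \<in> A; y \<in> A\<rbrakk> \<Longrightarrow> induced_le jn x y \<longleftrightarrow> mt x y = x"
  by (metis induced_le_def jn_commute jn_mt_absorb mt_commute mt_jn_absorb)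

lemma jn_le_iff:
  assumes "x \<in> A" "y \<in> A" "z \<in> A"
  shows "induced_le jn (jn x y) z \<longleftrightarrow> induced_le jn x z \<and> induced_le jn y z"
proof -
  have "induced_le jn x (jn x y)" "induced_le jn y (jn x y)"
    using assms by (metis induced_le_def jn_assoc jn_commute jn_idem)+
  then show ?thesis
    using assms by (metis induced_le_def induced_le_trans jn_assoc jn_closed)
qed

lemma le_mt_iff:
  assumes "x \<in> A" "y \<in> A" "z \<in> A"
  shows "induced_le jn z (mt x y) \<longleftrightarrow> induced_le jn z x \<and> induced_le jn z y"
proof -
  have "induced_le jn (mt x y) x" "induced_le jn (mt x y) y"
    using assms by (metis induced_le_def jn_commute jn_mt_absorb mt_closed mt_commute)+
  then show ?thesis
    using assms by (metis induced_le_iff_mt induced_le_trans mt_assoc mt_closed)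
qed

text \<open>The order version of the Yoneda principle, by which the identities below are
  derived from adjunctions.\<close>

lemma eq_if_same_upper_bounds:
  assumes "x \<in> A" "y \<in> A" "\<And>z. z \<in> A \<Longrightarrow> induced_le jn x z \<longleftrightarrow> induced_le jn y z"
  shows "x = y"
  using assms by (meson induced_le_antisym induced_le_refl)

lemma eq_if_same_lower_bounds:
  assumes "x \<in> A" "y \<in> A" "\<And>z. z \<in> A \<Longrightarrow> induced_le jn z x \<longleftrightarrow> induced_le jn z y"
  shows "x = y"
  using assms by (meson induced_le_antisym induced_le_refl)

end

section \<open>Transport of commutative semirings\<close>

lemma comm_semiringI:
  fixes S (structure)
  assumes "comm_monoid (add_monoid S)" and "comm_monoid S"
    and "\<And>x y z. \<lbrakk>x \<in> carrier S; y \<in> carrier S; z \<in> carrier S\<rbrakk>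
           \<Longrightarrow> x \<otimes> (y \<oplus> z) = (x \<otimes> y) \<oplus> (x \<otimes> z)"
    and "\<And>x. x \<in> carrier S \<Longrightarrow> x \<otimes> \<zero> = \<zero>"
  shows "comm_semiring S"
proof -
  interpret add: abelian_monoid S using assms(1) by (rule abelian_monoid.intro)
  interpret comm_monoid S by fact
  have "semiring S"
    by unfold_locales (use assms(3,4) in \<open>simp_all add: m_comm\<close>)
  then show ?thesis using \<open>comm_monoid S\<close> by (simp add: comm_semiring_def)
qed

text \<open>The isomorphism supplies closure of \<open>T\<close> as well as its laws: every element of the carrier of \<open>T\<close>
  has the form \<open>h x\<close> with \<open>x\<close> in \<open>S\<close>, so each law is the image of the same law in \<open>S\<close>.\<close>

lemma comm_semiring_transport:
  assumes S: "comm_semiring S" and h: "h \<in> semiring_iso S T"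
  shows "comm_semiring T"
proof -
  interpret S: semiring S using S by (simp add: comm_semiring_def)
  interpret Sm: comm_monoid S using S by (simp add: comm_semiring_def)
  have img: "carrier T = h ` carrier S"
    and one: "\<one>\<^bsub>T\<^esub> = h \<one>\<^bsub>S\<^esub>" and zero: "\<zero>\<^bsub>T\<^esub> = h \<zero>\<^bsub>S\<^esub>"
    using h by (auto simp: semiring_iso_def ring_iso_def ring_hom_def bij_betw_def)
  have mult: "h x \<otimes>\<^bsub>T\<^esub> h y = h (x \<otimes>\<^bsub>S\<^esub> y)" and add: "h x \<oplus>\<^bsub>T\<^esub> h y = h (x \<oplus>\<^bsub>S\<^esub> y)"
    if "x \<in> carrier S" "y \<in> carrier S" for x y
    using h that by (auto simp: semiring_iso_def ring_iso_def ring_hom_def)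
  show ?thesis
  proof (rule comm_semiringI)
    show "comm_monoid (add_monoid T)"
      by (rule comm_monoidI) (auto simp: img zero add S.a_assoc intro: arg_cong[OF S.a_comm])
    show "comm_monoid T"
      by (rule comm_monoidI) (auto simp: img one mult S.m_assoc intro: arg_cong[OF Sm.m_comm])
  qed (auto simp: img zero mult add S.r_distr)
qed

section \<open>Residuated lattices\<close>

locale residuated =
  fixes L :: "('a, 'm) reslat_scheme"
  assumes residuated_lattice: "residuated_lattice L"
begin

sublocale bounded_lattice_on "carrier L" "rl_join L" "rl_meet L" "rl_zero L" "rl_one L"
  using residuated_lattice by (simp add: residuated_lattice_def)

sublocale mult: comm_monoid "\<lparr>carrier = carrier L, monoid.mult = rl_mult L, one = rl_one L\<rparr>"
  rewrites "carrier \<lparr>carrier = carrier L, monoid.mult = rl_mult L, one = rl_one L\<rparr> = carrier L"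
    and "monoid.mult \<lparr>carrier = carrier L, monoid.mult = rl_mult L, one = rl_one L\<rparr> = rl_mult L"
    and "one \<lparr>carrier = carrier L, monoid.mult = rl_mult L, one = rl_one L\<rparr> = rl_one L"
  using residuated_lattice by (simp_all add: residuated_lattice_def)

abbreviation le (infix "\<preceq>" 50) where "le \<equiv> induced_le (rl_join L)"

lemma le_imp_iff:
  "\<lbrakk>x \<in> carrier L; y \<in> carrier L; z \<in> carrier L\<rbrakk>
    \<Longrightarrow> x \<preceq> rl_imp L y z \<longleftrightarrow> rl_mult L x y \<preceq> z"
  using residuated_lattice by (simp add: residuated_lattice_def rl_le_def)

lemma imp_closed:
  "\<lbrakk>x \<in> carrier L; y \<in> carrier L\<rbrakk> \<Longrightarrow> rl_imp L x y \<in> carrier L"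
  using residuated_lattice by (simp add: residuated_lattice_def)

lemma neg_closed: "x \<in> carrier L \<Longrightarrow> rl_neg L x \<in> carrier L"
  by (simp add: rl_neg_def imp_closed least_closed)

lemma mult_le_iff:
  assumes "x \<in> carrier L" "y \<in> carrier L" "z \<in> carrier L"
  shows "rl_mult L x y \<preceq> z \<longleftrightarrow> y \<preceq> rl_imp L x z"
  using assms by (simp add: le_imp_iff mult.m_comm)

text \<open>Both sides have the same upper bounds: a bound of either moves across the adjunction to a bound
  of \<open>y\<close> and \<open>z\<close>. The next lemma is the same argument for the empty join.\<close>

lemma mult_join_distrib:
  assumes "x \<in> carrier L" "y \<in> carrier L" "z \<in> carrier L"
  shows "rl_mult L x (rl_join L y z) = rl_join L (rl_mult L x y) (rl_mult L x z)"
  by (rule eq_if_same_upper_bounds)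
    (use assms in \<open>simp_all add: jn_closed mult_le_iff jn_le_iff imp_closed\<close>)

lemma mult_zero:
  assumes "x \<in> carrier L"
  shows "rl_mult L x (rl_zero L) = rl_zero L"
  by (rule eq_if_same_upper_bounds)
    (use assms in \<open>simp_all add: least_closed mult_le_iff imp_closed least\<close>)

lemma le_neg_iff:
  "\<lbrakk>x \<in> carrier L; y \<in> carrier L\<rbrakk> \<Longrightarrow> x \<preceq> rl_neg L y \<longleftrightarrow> rl_mult L x y \<preceq> rl_zero L"
  by (simp add: rl_neg_def le_imp_iff least_closed)

text \<open>An element lies below \<open>\<not> u\<close> exactly when its product with \<open>u\<close> is \<open>0\<close>; by distributivity
  it annihilates a join exactly when it annihilates both joinands.\<close>

lemma neg_join:
  assumes "x \<in> carrier L" "y \<in> carrier L"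
  shows "rl_neg L (rl_join L x y) = rl_meet L (rl_neg L x) (rl_neg L y)"
  by (rule eq_if_same_lower_bounds)
    (use assms in \<open>simp_all add: neg_closed jn_closed mt_closed le_mt_iff le_neg_iff
      mult_join_distrib jn_le_iff least_closed\<close>)

lemma neg_eq_one_iff:
  assumes "x \<in> carrier L"
  shows "rl_neg L x = rl_one L \<longleftrightarrow> x \<preceq> rl_zero L"
proof -
  have "rl_neg L x = rl_one L \<longleftrightarrow> rl_one L \<preceq> rl_neg L x"
    using assms by (metis greatest greatest_closed induced_le_antisym neg_closed)
  then show ?thesis
    using assms by (simp add: le_neg_iff greatest_closed)
qed

lemma neg_zero: "rl_neg L (rl_zero L) = rl_one L"
  by (simp add: neg_eq_one_iff least_closed least)

lemma neg_one: "rl_neg L (rl_one L) = rl_zero L"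
  by (rule eq_if_same_lower_bounds)
    (simp_all add: neg_closed greatest_closed least_closed le_neg_iff)

lemma join_mult_comm_semiring:
  "comm_semiring \<lparr>carrier = carrier L, monoid.mult = rl_mult L, one = rl_one L,
     zero = rl_zero L, add = rl_join L\<rparr>"
proof (rule comm_semiringI)
  show "comm_monoid (add_monoid \<lparr>carrier = carrier L, monoid.mult = rl_mult L, one = rl_one L,
     zero = rl_zero L, add = rl_join L\<rparr>)"
    by (rule comm_monoidI)
      (use least in \<open>auto simp: jn_closed least_closed jn_assoc induced_le_def intro: jn_commute\<close>)
  show "comm_monoid \<lparr>carrier = carrier L, monoid.mult = rl_mult L, one = rl_one L,
     zero = rl_zero L, add = rl_join L\<rparr>"
    by (rule comm_monoidI) (auto simp: mult.m_assoc intro: mult.m_comm)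
qed (simp_all add: mult_join_distrib mult_zero)

end

section \<open>The double negation law\<close>

locale involutive_residuated = residuated +
  assumes double_negation: "double_negation_law L"
begin

lemma neg_neg: "x \<in> carrier L \<Longrightarrow> rl_neg L (rl_neg L x) = x"
  using double_negation by (simp add: double_negation_law_def)

lemma neg_mult:
  "\<lbrakk>x \<in> carrier L; y \<in> carrier L\<rbrakk>
    \<Longrightarrow> rl_neg L (rl_mult L x y) = rl_oplus L (rl_neg L x) (rl_neg L y)"
  by (simp add: rl_oplus_def neg_neg)

lemma neg_semiring_iso:
  "rl_neg L \<in> semiring_iso
     \<lparr>carrier = carrier L, monoid.mult = rl_mult L, one = rl_one L,
        zero = rl_zero L, add = rl_join L\<rparr>
     \<lparr>carrier = carrier L, monoid.mult = rl_oplus L, one = rl_zero L,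
        zero = rl_one L, add = rl_meet L\<rparr>"
proof -
  have "bij_betw (rl_neg L) (carrier L) (carrier L)"
    by (rule bij_betw_byWitness[where f' = "rl_neg L"]) (auto simp: neg_neg neg_closed)
  then show ?thesis
    by (auto simp: semiring_iso_def ring_iso_def ring_hom_def neg_closed neg_mult neg_join
        neg_zero neg_one)
qed

lemma le_iff_neg_oplus_eq_one:
  assumes "x \<in> carrier L" "y \<in> carrier L"
  shows "x \<preceq> y \<longleftrightarrow> rl_oplus L (rl_neg L x) y = rl_one L"
proof -
  have "x \<preceq> y \<longleftrightarrow> x \<preceq> rl_neg L (rl_neg L y)"
    using assms by (simp add: neg_neg)
  also have "\<dots> \<longleftrightarrow> rl_mult L x (rl_neg L y) \<preceq> rl_zero L"
    using assms by (simp add: le_neg_iff neg_closed)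
  also have "\<dots> \<longleftrightarrow> rl_oplus L (rl_neg L x) y = rl_one L"
    using assms by (simp add: rl_oplus_def neg_neg neg_eq_one_iff neg_closed)
  finally show ?thesis .
qed

end

theorem theorem9:
  fixes L :: "'a reslat"
  assumes "residuated_lattice L"
    and "double_negation_law L"
  shows "general_coupled_semiring (coupled_of_reslat L)"
proof -
  interpret involutive_residuated L
    using assms by unfold_locales
  show ?thesis
    using join_mult_comm_semiring comm_semiring_transport[OF join_mult_comm_semiring neg_semiring_iso]
      neg_semiring_iso lattice_on_axioms
    by (simp add: coupled_of_reslat_def neg_neg le_iff_neg_oplus_eq_one)
qed

end
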